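(* Let $(M,g,\nabla^0)$ be a Hessian manifold satisfying the Associativity Equation. Then, in affine coordinates and for all indices $a,b,c,d$, the following equation is satisfied: $$\sum_f\Phi^f_{ab}\,\nabla^0_f g_{cd}=\sum_f\Phi^f_{bc}\,\nabla^0_f g_{ad}.$$
   Context: A Hessian manifold $(M,g,\nabla^0)$ is a smooth manifold $M$ with a flat torsionless affine connection $\nabla^0$ and a Riemannian metric $g$ which, in affine local coordinates $(x^1,\dots,x^n)$ (i.e. $\nabla^0(dx^i)=0$), is $g_{ij}=\partial_i\partial_j\Phi$ for a local smooth real-valued function $\Phi$. Put $\Phi_{ijk}=\partial_i\partial_j\partial_k\Phi$, $[g^{ef}]=[g_{ef}]^{-1}$ and $\Phi^f_{ij}=\sum_k\Phi_{ijk}g^{kf}$; $\nabla^0_fg_{cd}$ denotes the component $(\nabla^0_{\partial_f}g)(\partial_c,\partial_d)$. The Associativity Equation is: for all $a,b,c,d$, $$\sum_{e,f}\partial_a\partial_b\partial_e\Phi\; g^{ef}\;\partial_f\partial_c\partial_d\Phi=\sum_{e,f}\partial_b\partial_c\partial_e\Phi\; g^{ef}\;\partial_f\partial_a\partial_d\Phi.$$ *)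

theory Defs
  imports "HOL-Analysis.Analysis"
begin

section \<open>Smooth maps between open subsets of normed spaces\<close>

primrec Ck_on :: "nat \<Rightarrow> 'b::real_normed_vector set \<Rightarrow> ('b \<Rightarrow> 'c::real_normed_vector) \<Rightarrow> bool" where
  "Ck_on 0 S f \<longleftrightarrow> continuous_on S f"
| "Ck_on (Suc k) S f \<longleftrightarrow>
     (\<forall>x\<in>S. f differentiable (at x)) \<and> (\<forall>w. Ck_on k S (\<lambda>x. frechet_derivative f (at x) w))"

text \<open>This is intended for open \<open>S\<close> in finite-dimensional spaces.\<close>

definition smooth_on :: "'b::real_normed_vector set \<Rightarrow> ('b \<Rightarrow> 'c::real_normed_vector) \<Rightarrow> bool" where
  "smooth_on S f \<longleftrightarrow> (\<forall>k. Ck_on k S f)"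


section \<open>Smooth manifolds\<close>

text \<open>A coordinate system is a pair of a domain and a map; the values of the map outside the
  domain are irrelevant.\<close>

type_synonym ('a, 'n) chart = "'a set \<times> ('a \<Rightarrow> real ^ 'n)"

abbreviation chart_dom :: "('a, 'n) chart \<Rightarrow> 'a set" where
  "chart_dom c \<equiv> fst c"

abbreviation chart_map :: "('a, 'n) chart \<Rightarrow> 'a \<Rightarrow> real ^ 'n" where
  "chart_map c \<equiv> snd c"

abbreviation chart_inv :: "('a, 'n) chart \<Rightarrow> real ^ 'n \<Rightarrow> 'a" where
  "chart_inv c \<equiv> inv_into (chart_dom c) (chart_map c)"

definition is_chart :: "'a topology \<Rightarrow> ('a, 'n::finite) chart \<Rightarrow> bool" where
  "is_chart M c \<longleftrightarrow>
     openin M (chart_dom c) \<and> open (chart_map c ` chart_dom c) \<and>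
     homeomorphic_map (subtopology M (chart_dom c))
       (top_of_set (chart_map c ` chart_dom c)) (chart_map c)"

definition compatible :: "('a, 'n::finite) chart \<Rightarrow> ('a, 'n) chart \<Rightarrow> bool" where
  "compatible c d \<longleftrightarrow>
     smooth_on (chart_map c ` (chart_dom c \<inter> chart_dom d)) (chart_map d \<circ> chart_inv c) \<and>
     smooth_on (chart_map d ` (chart_dom c \<inter> chart_dom d)) (chart_map c \<circ> chart_inv d)"

text \<open>The set \<open>A\<close> is a maximal smooth atlas, so its elements are all the smooth charts.\<close>

definition smooth_manifold :: "'a topology \<Rightarrow> ('a, 'n::finite) chart set \<Rightarrow> bool" where
  "smooth_manifold M A \<longleftrightarrow>
     Hausdorff_space M \<and> second_countable M \<and>
     (\<forall>c\<in>A. is_chart M c) \<and> (\<Union>c\<in>A. chart_dom c) = topspace M \<and>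
     (\<forall>c\<in>A. \<forall>d\<in>A. compatible c d) \<and>
     (\<forall>c. is_chart M c \<and> (\<forall>d\<in>A. compatible c d) \<longrightarrow> c \<in> A)"

definition smooth_fun :: "('a, 'n::finite) chart set \<Rightarrow> 'a set \<Rightarrow> ('a \<Rightarrow> real) \<Rightarrow> bool" where
  "smooth_fun A W f \<longleftrightarrow>
     (\<forall>c\<in>A. smooth_on (chart_map c ` (chart_dom c \<inter> W)) (f \<circ> chart_inv c))"

definition smooth_at ::
    "'a topology \<Rightarrow> ('a, 'n::finite) chart set \<Rightarrow> 'a \<Rightarrow> ('a \<Rightarrow> real) \<Rightarrow> bool" where
  "smooth_at M A p f \<longleftrightarrow> (\<exists>W. openin M W \<and> p \<in> W \<and> smooth_fun A W f)"


section \<open>Tangent vectors and vector fields\<close>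

text \<open>Tangent vectors at \<open>p\<close> act as directional derivatives on the functions that are smooth near
  \<open>p\<close>. They are set to \<open>0\<close> on all other functions, so that a vector is determined by its action on
  the smooth ones.\<close>

type_synonym 'a tvec = "('a \<Rightarrow> real) \<Rightarrow> real"

type_synonym 'a vfield = "'a \<Rightarrow> 'a tvec"

definition chart_vec :: "'a topology \<Rightarrow> ('a, 'n::finite) chart set \<Rightarrow> ('a, 'n) chart \<Rightarrow>
    real ^ 'n \<Rightarrow> 'a vfield" where
  "chart_vec M A c w p f =
     (if smooth_at M A p f
      then frechet_derivative (f \<circ> chart_inv c) (at (chart_map c p)) w else 0)"

definition tangent_space :: "'a topology \<Rightarrow> ('a, 'n::finite) chart set \<Rightarrow> 'a \<Rightarrow> 'a tvec set" where
  "tangent_space M A p = {chart_vec M A c w p | c w. c \<in> A \<and> p \<in> chart_dom c}"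

text \<open>The coordinate vector field \<open>\<partial>\<^sub>i\<close> of a chart.\<close>

definition coord_field :: "'a topology \<Rightarrow> ('a, 'n::finite) chart set \<Rightarrow> ('a, 'n) chart \<Rightarrow>
    'n \<Rightarrow> 'a vfield" where
  "coord_field M A c i = chart_vec M A c (axis i 1)"

text \<open>Only the values of \<open>X\<close> on the open set \<open>W\<close> matter.\<close>

definition vector_field_on ::
    "'a topology \<Rightarrow> ('a, 'n::finite) chart set \<Rightarrow> 'a set \<Rightarrow> 'a vfield \<Rightarrow> bool" where
  "vector_field_on M A W X \<longleftrightarrow>
     openin M W \<and> (\<forall>p\<in>W. X p \<in> tangent_space M A p) \<and>
     (\<forall>V f. openin M V \<and> V \<subseteq> W \<and> smooth_fun A V f \<longrightarrow> smooth_fun A V (\<lambda>p. X p f))"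

definition vf_add :: "'a vfield \<Rightarrow> 'a vfield \<Rightarrow> 'a vfield" where
  "vf_add X Y = (\<lambda>p f. X p f + Y p f)"

definition vf_mult :: "('a \<Rightarrow> real) \<Rightarrow> 'a vfield \<Rightarrow> 'a vfield" where
  "vf_mult h X = (\<lambda>p f. h p * X p f)"

definition lie_bracket :: "'a topology \<Rightarrow> ('a, 'n::finite) chart set \<Rightarrow>
    'a vfield \<Rightarrow> 'a vfield \<Rightarrow> 'a vfield" where
  "lie_bracket M A X Y p f =
     (if smooth_at M A p f then X p (\<lambda>q. Y q f) - Y p (\<lambda>q. X q f) else 0)"


section \<open>Riemannian metrics\<close>

type_synonym 'a metric2 = "'a \<Rightarrow> 'a tvec \<Rightarrow> 'a tvec \<Rightarrow> real"

definition riemannian_metric ::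
    "'a topology \<Rightarrow> ('a, 'n::finite) chart set \<Rightarrow> 'a metric2 \<Rightarrow> bool" where
  "riemannian_metric M A g \<longleftrightarrow>
     (\<forall>p\<in>topspace M. \<forall>u\<in>tangent_space M A p. \<forall>v\<in>tangent_space M A p.
        g p u v = g p v u \<and>
        (u \<noteq> (\<lambda>f. 0) \<longrightarrow> g p u u > 0) \<and>
        (\<forall>w\<in>tangent_space M A p. \<forall>r s.
           g p (\<lambda>f. r * u f + s * v f) w = r * g p u w + s * g p v w)) \<and>
     (\<forall>W X Y. vector_field_on M A W X \<and> vector_field_on M A W Y \<longrightarrow>
        smooth_fun A W (\<lambda>p. g p (X p) (Y p)))"


section \<open>Affine connections\<close>

text \<open>A connection is given together with its restrictions to all open subsets: it acts on vector
  fields over any open \<open>W\<close>, and locality makes these actions agree on overlaps. Linearity over the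
  constants in the second argument is contained in the Leibniz rule.\<close>

type_synonym 'a conn = "'a vfield \<Rightarrow> 'a vfield \<Rightarrow> 'a vfield"

definition affine_connection ::
    "'a topology \<Rightarrow> ('a, 'n::finite) chart set \<Rightarrow> 'a conn \<Rightarrow> bool" where
  "affine_connection M A nabla \<longleftrightarrow>
     (\<forall>W X Y. vector_field_on M A W X \<and> vector_field_on M A W Y \<longrightarrow>
        vector_field_on M A W (nabla X Y) \<and>
        (\<forall>X' Y'. vector_field_on M A W X' \<and> vector_field_on M A W Y' \<and>
           (\<forall>p\<in>W. X' p = X p \<and> Y' p = Y p) \<longrightarrow> (\<forall>p\<in>W. nabla X' Y' p = nabla X Y p)) \<and>
        (\<forall>X'. vector_field_on M A W X' \<longrightarrow>
           (\<forall>p\<in>W. nabla (vf_add X X') Y p = vf_add (nabla X Y) (nabla X' Y) p)) \<and>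
        (\<forall>Y'. vector_field_on M A W Y' \<longrightarrow>
           (\<forall>p\<in>W. nabla X (vf_add Y Y') p = vf_add (nabla X Y) (nabla X Y') p)) \<and>
        (\<forall>h. smooth_fun A W h \<longrightarrow>
           (\<forall>p\<in>W. nabla (vf_mult h X) Y p = vf_mult h (nabla X Y) p \<and>
              nabla X (vf_mult h Y) p =
                vf_add (vf_mult h (nabla X Y)) (vf_mult (\<lambda>q. X q h) Y) p)))"

definition torsion_free ::
    "'a topology \<Rightarrow> ('a, 'n::finite) chart set \<Rightarrow> 'a conn \<Rightarrow> bool" where
  "torsion_free M A nabla \<longleftrightarrow>
     (\<forall>W X Y. vector_field_on M A W X \<and> vector_field_on M A W Y \<longrightarrow>
        (\<forall>p\<in>W. \<forall>f. nabla X Y p f - nabla Y X p f - lie_bracket M A X Y p f = 0))"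

definition flat_connection ::
    "'a topology \<Rightarrow> ('a, 'n::finite) chart set \<Rightarrow> 'a conn \<Rightarrow> bool" where
  "flat_connection M A nabla \<longleftrightarrow>
     (\<forall>W X Y Z. vector_field_on M A W X \<and> vector_field_on M A W Y \<and> vector_field_on M A W Z \<longrightarrow>
        (\<forall>p\<in>W. \<forall>f. nabla X (nabla Y Z) p f - nabla Y (nabla X Z) p f
           - nabla (lie_bracket M A X Y) Z p f = 0))"

text \<open>\<open>(\<nabla>\<^sub>X \<alpha>)(Y)\<close> for a 1-form \<open>\<alpha>\<close>, and \<open>(\<nabla>\<^sub>X g)(Y, Z)\<close> for a 2-tensor \<open>g\<close>.\<close>

definition cov_deriv_form ::
    "'a conn \<Rightarrow> ('a \<Rightarrow> 'a tvec \<Rightarrow> real) \<Rightarrow> 'a vfield \<Rightarrow> 'a vfield \<Rightarrow> 'a \<Rightarrow> real" where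
  "cov_deriv_form nabla \<alpha> X Y p = X p (\<lambda>q. \<alpha> q (Y q)) - \<alpha> p (nabla X Y p)"

definition cov_deriv_metric ::
    "'a conn \<Rightarrow> 'a metric2 \<Rightarrow> 'a vfield \<Rightarrow> 'a vfield \<Rightarrow> 'a vfield \<Rightarrow> 'a \<Rightarrow> real" where
  "cov_deriv_metric nabla g X Y Z p =
     X p (\<lambda>q. g q (Y q) (Z q)) - g p (nabla X Y p) (Z p) - g p (Y p) (nabla X Z p)"

definition differential :: "('a \<Rightarrow> real) \<Rightarrow> 'a \<Rightarrow> 'a tvec \<Rightarrow> real" where
  "differential f p v = v f"

text \<open>Affine coordinates: \<open>\<nabla>(dx\<^sup>i) = 0\<close> on the domain of the chart.\<close>

definition affine_chart ::
    "'a topology \<Rightarrow> ('a, 'n::finite) chart set \<Rightarrow> 'a conn \<Rightarrow> ('a, 'n) chart \<Rightarrow> bool" where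
  "affine_chart M A nabla c \<longleftrightarrow>
     c \<in> A \<and>
     (\<forall>i W X Y. W \<subseteq> chart_dom c \<and> vector_field_on M A W X \<and> vector_field_on M A W Y \<longrightarrow>
        (\<forall>p\<in>W. cov_deriv_form nabla (differential (\<lambda>q. chart_map c q $ i)) X Y p = 0))"


section \<open>Hessian manifolds\<close>

text \<open>\<open>\<partial>\<^sub>i\<partial>\<^sub>j\<Phi>\<close> and \<open>\<partial>\<^sub>i\<partial>\<^sub>j\<partial>\<^sub>k\<Phi>\<close> in the coordinates \<open>c\<close>.\<close>

definition pd2 :: "'a topology \<Rightarrow> ('a, 'n::finite) chart set \<Rightarrow> ('a, 'n) chart \<Rightarrow>
    ('a \<Rightarrow> real) \<Rightarrow> 'n \<Rightarrow> 'n \<Rightarrow> 'a \<Rightarrow> real" where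
  "pd2 M A c \<Phi> i j p = coord_field M A c i p (\<lambda>q. coord_field M A c j q \<Phi>)"

definition pd3 :: "'a topology \<Rightarrow> ('a, 'n::finite) chart set \<Rightarrow> ('a, 'n) chart \<Rightarrow>
    ('a \<Rightarrow> real) \<Rightarrow> 'n \<Rightarrow> 'n \<Rightarrow> 'n \<Rightarrow> 'a \<Rightarrow> real" where
  "pd3 M A c \<Phi> i j k p = coord_field M A c i p (\<lambda>q. pd2 M A c \<Phi> j k q)"

definition metric_matrix :: "'a topology \<Rightarrow> ('a, 'n::finite) chart set \<Rightarrow> 'a metric2 \<Rightarrow>
    ('a, 'n) chart \<Rightarrow> 'a \<Rightarrow> real ^ 'n ^ 'n" where
  "metric_matrix M A g c p = (\<chi> i j. g p (coord_field M A c i p) (coord_field M A c j p))"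

definition inv_metric :: "'a topology \<Rightarrow> ('a, 'n::finite) chart set \<Rightarrow> 'a metric2 \<Rightarrow>
    ('a, 'n) chart \<Rightarrow> 'n \<Rightarrow> 'n \<Rightarrow> 'a \<Rightarrow> real" where
  "inv_metric M A g c e f p = matrix_inv (metric_matrix M A g c p) $ e $ f"

text \<open>\<open>\<Phi>\<close> is a potential of \<open>g\<close> on the open part \<open>W\<close> of the domain of \<open>c\<close>.\<close>

definition potential_on :: "'a topology \<Rightarrow> ('a, 'n::finite) chart set \<Rightarrow> 'a metric2 \<Rightarrow>
    ('a, 'n) chart \<Rightarrow> 'a set \<Rightarrow> ('a \<Rightarrow> real) \<Rightarrow> bool" where
  "potential_on M A g c W \<Phi> \<longleftrightarrow>
     openin M W \<and> W \<subseteq> chart_dom c \<and> smooth_fun A W \<Phi> \<and>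
     (\<forall>p\<in>W. \<forall>i j. metric_matrix M A g c p $ i $ j = pd2 M A c \<Phi> i j p)"

definition hessian_manifold :: "'a topology \<Rightarrow> ('a, 'n::finite) chart set \<Rightarrow> 'a metric2 \<Rightarrow>
    'a conn \<Rightarrow> bool" where
  "hessian_manifold M A g nabla \<longleftrightarrow>
     smooth_manifold M A \<and> riemannian_metric M A g \<and>
     affine_connection M A nabla \<and> flat_connection M A nabla \<and> torsion_free M A nabla \<and>
     (\<forall>c. affine_chart M A nabla c \<longrightarrow>
        (\<forall>p\<in>chart_dom c. \<exists>W \<Phi>. p \<in> W \<and> potential_on M A g c W \<Phi>))"

text \<open>\<open>\<Phi>\<^sup>f\<^sub>i\<^sub>j\<close>, the last index of \<open>\<Phi>\<^sub>i\<^sub>j\<^sub>k\<close> being raised with the metric.\<close>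

definition pd3_up :: "'a topology \<Rightarrow> ('a, 'n::finite) chart set \<Rightarrow> 'a metric2 \<Rightarrow>
    ('a, 'n) chart \<Rightarrow> ('a \<Rightarrow> real) \<Rightarrow> 'n \<Rightarrow> 'n \<Rightarrow> 'n \<Rightarrow> 'a \<Rightarrow> real" where
  "pd3_up M A g c \<Phi> f i j p = (\<Sum>k\<in>UNIV. pd3 M A c \<Phi> i j k p * inv_metric M A g c k f p)"

definition associativity_equation :: "'a topology \<Rightarrow> ('a, 'n::finite) chart set \<Rightarrow> 'a metric2 \<Rightarrow>
    'a conn \<Rightarrow> bool" where
  "associativity_equation M A g nabla \<longleftrightarrow>
     (\<forall>c W \<Phi>. affine_chart M A nabla c \<and> potential_on M A g c W \<Phi> \<longrightarrow>
        (\<forall>p\<in>W. \<forall>i j k l.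
           (\<Sum>e\<in>UNIV. \<Sum>f\<in>UNIV.
              pd3 M A c \<Phi> i j e p * inv_metric M A g c e f p * pd3 M A c \<Phi> f k l p) =
           (\<Sum>e\<in>UNIV. \<Sum>f\<in>UNIV.
              pd3 M A c \<Phi> j k e p * inv_metric M A g c e f p * pd3 M A c \<Phi> f i l p)))"

text \<open>The component \<open>\<nabla>\<^sub>f g\<^sub>i\<^sub>j = (\<nabla>\<^bsub>\<partial>\<^sub>f\<^esub> g)(\<partial>\<^sub>i, \<partial>\<^sub>j)\<close>.\<close>

definition nabla_metric_comp :: "'a topology \<Rightarrow> ('a, 'n::finite) chart set \<Rightarrow> 'a metric2 \<Rightarrow>
    'a conn \<Rightarrow> ('a, 'n) chart \<Rightarrow> 'n \<Rightarrow> 'n \<Rightarrow> 'n \<Rightarrow> 'a \<Rightarrow> real" where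
  "nabla_metric_comp M A g nabla c f i j p =
     cov_deriv_metric nabla g (coord_field M A c f) (coord_field M A c i) (coord_field M A c j) p"

end

theory Submission
  imports Defs
begin

text \<open>
  In affine coordinates the vector fields \<open>\<partial>\<^sub>i\<close> are parallel: \<open>\<nabla>(dx\<^sup>k) = 0\<close> shows that \<open>\<nabla>\<^bsub>\<partial>\<^sub>i\<^esub>\<partial>\<^sub>j\<close>
  annihilates every coordinate function, and by the chain rule such a tangent vector vanishes. Hence
  the components of \<open>\<nabla>g\<close> are the plain partial derivatives of \<open>g\<^sub>i\<^sub>j = \<partial>\<^sub>i\<partial>\<^sub>j\<Phi>\<close>, that is the third
  derivatives of \<open>\<Phi>\<close>, and the claim becomes the Associativity Equation.
\<close>

section \<open>Calculus of smooth functions\<close>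

text \<open>\<open>frechet_derivative\<close> is a choice among all derivatives at \<open>x\<close>.
  Agreement near \<open>x\<close> makes the candidates for \<open>f\<close> and \<open>h\<close> the
  same, so the choices coincide even where no derivative exists.\<close>

lemma frechet_derivative_cong_open:
  assumes "open S" "x \<in> S" "\<And>y. y \<in> S \<Longrightarrow> f y = h y"
  shows "frechet_derivative f (at x) = frechet_derivative h (at x)"
proof -
  have "(f has_derivative f') (at x) \<longleftrightarrow> (h has_derivative f') (at x)" for f'
    using has_derivative_transform_within_open[of f f' x UNIV S h]
      has_derivative_transform_within_open[of h f' x UNIV S f] assms by auto
  then show ?thesis
    unfolding frechet_derivative_def by simp
qed

lemma differentiable_cong_open:
  assumes "open S" "x \<in> S" "\<And>y. y \<in> S \<Longrightarrow> f y = h y" "f differentiable (at x)"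
  shows "h differentiable (at x)"
proof -
  obtain f' where "(f has_derivative f') (at x)"
    using assms(4) by (auto simp: differentiable_def)
  then have "(h has_derivative f') (at x)"
    using assms(1-3) by (rule has_derivative_transform_within_open)
  then show ?thesis by (auto simp: differentiable_def)
qed

text \<open>Openness of \<open>S\<close> lets equality on \<open>S\<close> pass to the derivatives,
  so the induction goes through. The closure rules below rely on this, because their derivative
  formulas hold only at points of \<open>S\<close>.\<close>

lemma Ck_on_cong:
  assumes "open S" "\<And>y. y \<in> S \<Longrightarrow> f y = h y" "Ck_on k S f"
  shows "Ck_on k S h"
  using assms(2,3)
proof (induction k arbitrary: f h)
  case 0
  then show ?case using continuous_on_cong[OF refl, of S f h] by simp
next
  case (Suc k)
  have "Ck_on k S (\<lambda>x. frechet_derivative h (at x) w)" for w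
  proof (rule Suc.IH)
    show "Ck_on k S (\<lambda>x. frechet_derivative f (at x) w)"
      using Suc.prems(2) by simp
    show "frechet_derivative f (at x) w = frechet_derivative h (at x) w" if "x \<in> S" for x
      using frechet_derivative_cong_open[OF assms(1) that Suc.prems(1)] by simp
  qed
  moreover have "h differentiable (at x)" if "x \<in> S" for x
    using differentiable_cong_open[OF assms(1) that Suc.prems(1)] Suc.prems(2) that by simp
  ultimately show ?case by simp
qed

lemma Ck_on_subset: "Ck_on k S f \<Longrightarrow> T \<subseteq> S \<Longrightarrow> Ck_on k T f"
  by (induction k arbitrary: f) (auto intro: continuous_on_subset)

lemma Ck_on_Suc_imp: "Ck_on (Suc k) S f \<Longrightarrow> Ck_on k S f"
proof (induction k arbitrary: f)
  case 0
  then show ?case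
    by (auto intro!: continuous_at_imp_continuous_on differentiable_imp_continuous_within)
next
  case (Suc k)
  then show ?case by (metis Ck_on.simps(2))
qed

section \<open>Closure of C^k under sums, products, linear maps and composition\<close>

lemma Ck_on_const: "Ck_on k S (\<lambda>x. c)"
  by (induction k arbitrary: c) (auto simp: frechet_derivative_const)

lemma Ck_on_add:
  assumes "open S" "Ck_on k S f" "Ck_on k S h"
  shows "Ck_on k S (\<lambda>x. f x + h x)"
  using assms
proof (induction k arbitrary: f h)
  case 0
  then show ?case by (auto intro: continuous_on_add)
next
  case (Suc k)
  have deriv: "((\<lambda>x. f x + h x) has_derivative
      (\<lambda>w. frechet_derivative f (at x) w + frechet_derivative h (at x) w)) (at x)"
    if "x \<in> S" for x
    using Suc.prems that
    by (intro has_derivative_add frechet_derivative_works[THEN iffD1]) auto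
  have "Ck_on k S (\<lambda>x. frechet_derivative (\<lambda>x. f x + h x) (at x) w)" for w
  proof (rule Ck_on_cong[OF \<open>open S\<close>])
    show "Ck_on k S (\<lambda>x. frechet_derivative f (at x) w + frechet_derivative h (at x) w)"
      using Suc.prems by (intro Suc.IH) auto
    show "frechet_derivative f (at x) w + frechet_derivative h (at x) w =
        frechet_derivative (\<lambda>x. f x + h x) (at x) w" if "x \<in> S" for x
      using frechet_derivative_at[OF deriv[OF that]] by metis
  qed
  then show ?case using deriv by (auto simp: differentiable_def)
qed

lemma Ck_on_sum:
  assumes "open S" "\<And>i. i \<in> I \<Longrightarrow> Ck_on k S (f i)"
  shows "Ck_on k S (\<lambda>x. \<Sum>i\<in>I. f i x)"
  using assms(2) by (induction I rule: infinite_finite_induct)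
    (simp_all add: Ck_on_const Ck_on_add[OF assms(1)])

lemma Ck_on_mult:
  fixes f h :: "'b::real_normed_vector \<Rightarrow> real"
  assumes "open S" "Ck_on k S f" "Ck_on k S h"
  shows "Ck_on k S (\<lambda>x. f x * h x)"
  using assms
proof (induction k arbitrary: f h)
  case 0
  then show ?case by (auto intro: continuous_on_mult)
next
  case (Suc k)
  have deriv: "((\<lambda>x. f x * h x) has_derivative
      (\<lambda>w. f x * frechet_derivative h (at x) w + frechet_derivative f (at x) w * h x)) (at x)"
    if "x \<in> S" for x
    using Suc.prems that
    by (intro has_derivative_mult frechet_derivative_works[THEN iffD1]) auto
  have "Ck_on k S (\<lambda>x. frechet_derivative (\<lambda>x. f x * h x) (at x) w)" for w
  proof (rule Ck_on_cong[OF \<open>open S\<close>])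
    show "Ck_on k S (\<lambda>x. f x * frechet_derivative h (at x) w + frechet_derivative f (at x) w * h x)"
      \<comment> \<open>The Leibniz rule pairs each derivative, of order \<open>k\<close>, with an
        undifferentiated factor of order \<open>Suc k\<close>, whose order has to be lowered before
        the induction hypothesis applies.\<close>
      using Suc.prems Ck_on_Suc_imp[OF Suc.prems(2)] Ck_on_Suc_imp[OF Suc.prems(3)]
      by (intro Ck_on_add[OF \<open>open S\<close>] Suc.IH) simp_all
    show "f x * frechet_derivative h (at x) w + frechet_derivative f (at x) w * h x =
        frechet_derivative (\<lambda>x. f x * h x) (at x) w" if "x \<in> S" for x
      using frechet_derivative_at[OF deriv[OF that]] by metis
  qed
  then show ?case using deriv by (auto simp: differentiable_def)
qed

lemma Ck_on_bounded_linear: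
  assumes "open S" "bounded_linear L" "Ck_on k S f"
  shows "Ck_on k S (\<lambda>x. L (f x))"
  using assms(3)
proof (induction k arbitrary: f)
  case 0
  then show ?case by (auto intro: bounded_linear.continuous_on[OF assms(2)])
next
  case (Suc k)
  have deriv: "((\<lambda>x. L (f x)) has_derivative (\<lambda>w. L (frechet_derivative f (at x) w))) (at x)"
    if "x \<in> S" for x
    using Suc.prems that
    by (intro bounded_linear.has_derivative[OF assms(2)] frechet_derivative_works[THEN iffD1]) auto
  have "Ck_on k S (\<lambda>x. frechet_derivative (\<lambda>x. L (f x)) (at x) w)" for w
  proof (rule Ck_on_cong[OF \<open>open S\<close>])
    show "Ck_on k S (\<lambda>x. L (frechet_derivative f (at x) w))"
      using Suc.prems by (intro Suc.IH) auto
    show "L (frechet_derivative f (at x) w) = frechet_derivative (\<lambda>x. L (f x)) (at x) w"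
      if "x \<in> S" for x
      using frechet_derivative_at[OF deriv[OF that]] by metis
  qed
  then show ?case using deriv by (auto simp: differentiable_def)
qed

text \<open>\<open>Ck_on\<close> controls derivatives in a fixed direction only, whereas the chain
  rule differentiates \<open>f\<close> in the direction Dh(x)w, which varies with \<open>x\<close>.
  Expanding this direction in \<open>Basis\<close> leaves directional derivatives of
  \<open>f\<close> along constant vectors, composed with \<open>h\<close>, to which the induction
  hypothesis applies.\<close>

lemma Ck_on_compose:
  fixes f :: "'c::euclidean_space \<Rightarrow> real" and h :: "'b::real_normed_vector \<Rightarrow> 'c"
  assumes "open S" "h ` S \<subseteq> T" "Ck_on k T f" "Ck_on k S h"
  shows "Ck_on k S (f \<circ> h)"
  using assms
proof (induction k arbitrary: f)
  case 0
  then show ?case using continuous_on_compose[of S h f] continuous_on_subset[of T f] by simp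
next
  case (Suc k)
  have diff: "f differentiable (at (h x))" "h differentiable (at x)" if "x \<in> S" for x
    using Suc.prems that by auto
  have "Ck_on k S (\<lambda>x. frechet_derivative (f \<circ> h) (at x) w)" for w
  proof (rule Ck_on_cong[OF \<open>open S\<close>])
    show "Ck_on k S (\<lambda>x. \<Sum>b\<in>Basis. (frechet_derivative h (at x) w \<bullet> b) *
        ((\<lambda>y. frechet_derivative f (at y) b) \<circ> h) x)"
    proof (intro Ck_on_sum Ck_on_mult \<open>open S\<close>)
      fix b :: 'c
      show "Ck_on k S ((\<lambda>y. frechet_derivative f (at y) b) \<circ> h)"
        using Suc.prems Ck_on_Suc_imp[OF Suc.prems(4)] by (intro Suc.IH) auto
      show "Ck_on k S (\<lambda>x. frechet_derivative h (at x) w \<bullet> b)"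
        using Suc.prems by (intro Ck_on_bounded_linear[OF \<open>open S\<close> bounded_linear_inner_left]) auto
    qed
    show "(\<Sum>b\<in>Basis. (frechet_derivative h (at x) w \<bullet> b) *
        ((\<lambda>y. frechet_derivative f (at y) b) \<circ> h) x) = frechet_derivative (f \<circ> h) (at x) w"
      if "x \<in> S" for x
    proof -
      let ?v = "frechet_derivative h (at x) w"
      interpret D: linear "frechet_derivative f (at (h x))"
        using diff that by (intro linear_frechet_derivative)
      have "frechet_derivative f (at (h x)) ?v =
          frechet_derivative f (at (h x)) (\<Sum>b\<in>Basis. (?v \<bullet> b) *\<^sub>R b)"
        by (simp add: euclidean_representation)
      also have "\<dots> = (\<Sum>b\<in>Basis. (?v \<bullet> b) * frechet_derivative f (at (h x)) b)"
        by (simp add: D.sum D.scaleR)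
      finally show ?thesis
        using diff[OF that] by (simp add: frechet_derivative_compose)
    qed
  qed
  moreover have "(f \<circ> h) differentiable (at x)" if "x \<in> S" for x
    using diff[OF that] differentiable_chain_at by blast
  ultimately show ?case unfolding Ck_on.simps by blast
qed


section \<open>Charts\<close>

lemma is_chart_inj_on:
  assumes "is_chart M c"
  shows "inj_on (chart_map c) (chart_dom c)"
  using assms homeomorphic_imp_injective_map openin_subset[of M "chart_dom c"]
  unfolding is_chart_def by (metis inf.absorb_iff2 topspace_subtopology)

text \<open>A homeomorphism is an open map, so the image is open relative to the image of the chart
  domain, and the latter is open in the coordinate space.\<close>

lemma is_chart_open_image:
  assumes "is_chart M c" "openin M V"
  shows "open (chart_map c ` (chart_dom c \<inter> V))"
proof -
  have "open_map (subtopology M (chart_dom c)) (top_of_set (chart_map c ` chart_dom c)) (chart_map c)"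
    using assms(1) by (auto simp: is_chart_def dest: homeomorphic_imp_open_map)
  then have "openin (top_of_set (chart_map c ` chart_dom c)) (chart_map c ` (chart_dom c \<inter> V))"
    using assms(2) by (auto simp: open_map_def openin_subtopology_Int2)
  then show ?thesis
    using assms(1) by (auto simp: is_chart_def elim: openin_open_trans)
qed

lemma chart_inv_map:
  assumes "is_chart M c" "p \<in> chart_dom c"
  shows "chart_inv c (chart_map c p) = p"
  using assms by (simp add: is_chart_inj_on inv_into_f_f)

lemma smooth_manifold_chart: "smooth_manifold M A \<Longrightarrow> c \<in> A \<Longrightarrow> is_chart M c"
  by (simp add: smooth_manifold_def)

lemma chart_dom_openin: "is_chart M c \<Longrightarrow> openin M (chart_dom c)"
  by (simp add: is_chart_def)

lemma smooth_on_transition: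
  assumes "smooth_manifold M A" "c \<in> A" "d \<in> A"
  shows "smooth_on (chart_map c ` (chart_dom c \<inter> chart_dom d)) (chart_map d \<circ> chart_inv c)"
  using assms by (auto simp: smooth_manifold_def compatible_def)

lemma smooth_on_imp_differentiable: "smooth_on S f \<Longrightarrow> y \<in> S \<Longrightarrow> f differentiable (at y)"
  unfolding smooth_on_def by (metis Ck_on.simps(2))

section \<open>Locality of smoothness and of tangent vectors\<close>

lemma smooth_fun_cong:
  assumes M: "smooth_manifold M A" and V: "openin M V"
    and eq: "\<And>q. q \<in> V \<Longrightarrow> f q = h q" and f: "smooth_fun A V f"
  shows "smooth_fun A V h"
  unfolding smooth_fun_def smooth_on_def
proof (intro ballI allI)
  fix c k assume c: "c \<in> A"
  note ch = smooth_manifold_chart[OF M c]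
  show "Ck_on k (chart_map c ` (chart_dom c \<inter> V)) (h \<circ> chart_inv c)"
  proof (rule Ck_on_cong[OF is_chart_open_image[OF ch V]])
    show "Ck_on k (chart_map c ` (chart_dom c \<inter> V)) (f \<circ> chart_inv c)"
      using f c by (auto simp: smooth_fun_def smooth_on_def)
    show "(f \<circ> chart_inv c) y = (h \<circ> chart_inv c) y"
      if "y \<in> chart_map c ` (chart_dom c \<inter> V)" for y
      using that eq by (elim imageE) (simp add: chart_inv_map[OF ch])
  qed
qed

lemma smooth_fun_subset: "smooth_fun A V f \<Longrightarrow> U \<subseteq> V \<Longrightarrow> smooth_fun A U f"
  unfolding smooth_fun_def smooth_on_def
  by (blast intro: Ck_on_subset)

lemma smooth_at_cong_imp:
  assumes "smooth_manifold M A" "openin M V" "p \<in> V"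
    and "\<And>q. q \<in> V \<Longrightarrow> f q = h q" "smooth_at M A p f"
  shows "smooth_at M A p h"
proof -
  obtain U where "openin M U" "p \<in> U" "smooth_fun A U f"
    using assms(5) by (auto simp: smooth_at_def)
  then have "openin M (U \<inter> V)" "p \<in> U \<inter> V" "smooth_fun A (U \<inter> V) f"
    using assms by (auto intro: smooth_fun_subset)
  then show ?thesis
    using assms(4) smooth_fun_cong[OF assms(1), of "U \<inter> V" f h] by (auto simp: smooth_at_def)
qed

lemma chart_vec_cong:
  assumes M: "smooth_manifold M A" and c: "c \<in> A" "p \<in> chart_dom c"
    and V: "openin M V" "p \<in> V" and eq: "\<And>q. q \<in> V \<Longrightarrow> f q = h q"
  shows "chart_vec M A c w p f = chart_vec M A c w p h"
proof -
  note ch = smooth_manifold_chart[OF M c(1)]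
  \<comment> \<open>Both ingredients of \<open>chart_vec\<close> must be local: the case distinction
    on \<open>smooth_at\<close> and the derivative itself.\<close>
  have "smooth_at M A p f \<longleftrightarrow> smooth_at M A p h"
    using smooth_at_cong_imp[OF M V, of f h] smooth_at_cong_imp[OF M V, of h f] eq by auto
  moreover have "frechet_derivative (f \<circ> chart_inv c) (at (chart_map c p)) =
      frechet_derivative (h \<circ> chart_inv c) (at (chart_map c p))"
    by (rule frechet_derivative_cong_open[OF is_chart_open_image[OF ch V(1)]])
      (use c V eq in \<open>auto simp: chart_inv_map[OF ch]\<close>)
  ultimately show ?thesis by (simp add: chart_vec_def)
qed

lemma chart_vec_const:
  assumes M: "smooth_manifold M A" and c: "c \<in> A" "p \<in> chart_dom c"
    and V: "openin M V" "p \<in> V" and eq: "\<And>q. q \<in> V \<Longrightarrow> f q = r"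
  shows "chart_vec M A c w p f = 0"
proof -
  have "chart_vec M A c w p f = chart_vec M A c w p (\<lambda>q. r)"
    using assms by (intro chart_vec_cong)
  \<comment> \<open>Both branches of \<open>chart_vec\<close> give 0 on a constant, so its
    smoothness need not be decided.\<close>
  then show ?thesis
    by (simp add: chart_vec_def comp_def frechet_derivative_const)
qed

lemma smooth_at_imp_differentiable:
  assumes "smooth_at M A p f" "c \<in> A" "p \<in> chart_dom c"
  shows "(f \<circ> chart_inv c) differentiable (at (chart_map c p))"
proof -
  obtain W where "p \<in> W" "smooth_fun A W f"
    using assms(1) by (auto simp: smooth_at_def)
  then have "smooth_on (chart_map c ` (chart_dom c \<inter> W)) (f \<circ> chart_inv c)"
    using assms(2) by (simp add: smooth_fun_def)
  then show ?thesis
    using \<open>p \<in> W\<close> assms(3) by (intro smooth_on_imp_differentiable) auto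
qed

section \<open>Coordinate functions, vanishing of tangent vectors, coordinate fields\<close>

lemma smooth_fun_coord:
  assumes M: "smooth_manifold M A" and x: "x \<in> A"
  shows "smooth_fun A (chart_dom x) (\<lambda>q. chart_map x q $ i)"
  unfolding smooth_fun_def smooth_on_def
proof (intro ballI allI)
  fix c k assume c: "c \<in> A"
  \<comment> \<open>Read in the chart \<open>c\<close>, a coordinate of \<open>x\<close> is a
    component of the transition map from \<open>c\<close> to \<open>x\<close>.\<close>
  have "Ck_on k (chart_map c ` (chart_dom c \<inter> chart_dom x))
      (\<lambda>y. (chart_map x \<circ> chart_inv c) y $ i)"
  proof (rule Ck_on_bounded_linear[OF _ bounded_linear_vec_nth])
    show "open (chart_map c ` (chart_dom c \<inter> chart_dom x))"
      using smooth_manifold_chart[OF M] c x by (blast intro: is_chart_open_image chart_dom_openin)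
    show "Ck_on k (chart_map c ` (chart_dom c \<inter> chart_dom x)) (chart_map x \<circ> chart_inv c)"
      using smooth_on_transition[OF M c x] unfolding smooth_on_def by blast
  qed
  then show "Ck_on k (chart_map c ` (chart_dom c \<inter> chart_dom x))
      ((\<lambda>q. chart_map x q $ i) \<circ> chart_inv c)"
    by (simp add: comp_def)
qed

lemma smooth_at_coord:
  assumes "smooth_manifold M A" "x \<in> A" "p \<in> chart_dom x"
  shows "smooth_at M A p (\<lambda>q. chart_map x q $ i)"
  unfolding smooth_at_def
proof (intro exI conjI)
  show "openin M (chart_dom x)"
    by (rule chart_dom_openin[OF smooth_manifold_chart[OF assms(1,2)]])
  show "smooth_fun A (chart_dom x) (\<lambda>q. chart_map x q $ i)"
    by (rule smooth_fun_coord[OF assms(1,2)])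
qed (rule assms(3))

text \<open>Read in its own chart, a coordinate is a linear projection and is its own derivative.
  The resulting value, a Kronecker delta, is the same at every point of the domain.\<close>

lemma coord_field_coord:
  assumes M: "smooth_manifold M A" and x: "x \<in> A" "p \<in> chart_dom x"
  shows "coord_field M A x j p (\<lambda>q. chart_map x q $ i) = axis j 1 $ i"
proof -
  note ch = smooth_manifold_chart[OF M x(1)]
  have "frechet_derivative ((\<lambda>q. chart_map x q $ i) \<circ> chart_inv x) (at (chart_map x p)) =
      frechet_derivative (\<lambda>y. y $ i) (at (chart_map x p))"
    by (rule frechet_derivative_cong_open[OF is_chart_open_image[OF ch chart_dom_openin[OF ch]]])
      (use x in \<open>auto simp: chart_inv_map[OF ch]\<close>)
  also have "\<dots> = (\<lambda>y. y $ i)"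
    by (rule frechet_derivative_at[symmetric])
      (rule bounded_linear_imp_has_derivative[OF bounded_linear_vec_nth])
  finally show ?thesis
    using smooth_at_coord[OF assms] by (simp add: coord_field_def chart_vec_def)
qed

text \<open>The vector may be given by a direction \<open>w\<close> in another chart
  \<open>c\<close>. Its values on the coordinates of \<open>x\<close> are the components of
  D\<tau>(w) for the transition map \<open>\<tau>\<close>, so D\<tau>(w) = 0. The action on any
  smooth function factors through D\<tau>(w) by the chain rule.\<close>

lemma tangent_vector_eq_0:
  fixes A :: "('a, 'n::finite) chart set" and x :: "('a, 'n) chart"
  assumes M: "smooth_manifold M A" and x: "x \<in> A" "p \<in> chart_dom x"
    and v: "v \<in> tangent_space M A p"
    and zero: "\<And>i. v (\<lambda>q. chart_map x q $ i) = 0"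
  shows "v = (\<lambda>f. 0)"
proof
  fix f
  obtain c w where c: "c \<in> A" "p \<in> chart_dom c" and veq: "v = chart_vec M A c w p"
    using v by (auto simp: tangent_space_def)
  note chc = smooth_manifold_chart[OF M c(1)] and chx = smooth_manifold_chart[OF M x(1)]
  define \<tau> where "\<tau> = chart_map x \<circ> chart_inv c"
  define S where "S = chart_map c ` (chart_dom c \<inter> chart_dom x)"
  have S: "open S" "chart_map c p \<in> S"
    using is_chart_open_image[OF chc chart_dom_openin[OF chx]] c x by (auto simp: S_def)
  have \<tau>p: "\<tau> (chart_map c p) = chart_map x p"
    using chart_inv_map[OF chc c(2)] by (simp add: \<tau>_def)
  have d\<tau>: "\<tau> differentiable (at (chart_map c p))"
    using smooth_on_imp_differentiable[OF smooth_on_transition[OF M c(1) x(1)]] S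
    unfolding \<tau>_def S_def by blast
  have "frechet_derivative \<tau> (at (chart_map c p)) w $ i = 0" for i
  proof -
    have "((\<lambda>y. \<tau> y $ i) has_derivative (\<lambda>w. frechet_derivative \<tau> (at (chart_map c p)) w $ i))
        (at (chart_map c p))"
      by (intro bounded_linear.has_derivative[OF bounded_linear_vec_nth]
          frechet_derivative_works[THEN iffD1] d\<tau>)
    then have "frechet_derivative \<tau> (at (chart_map c p)) w $ i =
        frechet_derivative (\<lambda>y. \<tau> y $ i) (at (chart_map c p)) w"
      by (metis frechet_derivative_at)
    also have "\<dots> = v (\<lambda>q. chart_map x q $ i)"
      using smooth_at_coord[OF M x] by (simp add: veq chart_vec_def \<tau>_def comp_def)
    finally show ?thesis using zero by simp
  qed
  then have w0: "frechet_derivative \<tau> (at (chart_map c p)) w = 0"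
    by (simp add: vec_eq_iff)
  show "v f = 0"
  proof (cases "smooth_at M A p f")
    case True
    have df: "(f \<circ> chart_inv x) differentiable (at (\<tau> (chart_map c p)))"
      unfolding \<tau>p by (rule smooth_at_imp_differentiable[OF True x])
    \<comment> \<open>The factorization through \<open>\<tau>\<close> holds only over the overlap of
      the two charts, which is a neighbourhood of the point.\<close>
    have "frechet_derivative (f \<circ> chart_inv c) (at (chart_map c p)) =
        frechet_derivative ((f \<circ> chart_inv x) \<circ> \<tau>) (at (chart_map c p))"
      by (rule frechet_derivative_cong_open[OF S])
        (auto simp: S_def \<tau>_def chart_inv_map[OF chc] chart_inv_map[OF chx])
    then have "v f = frechet_derivative (f \<circ> chart_inv x) (at (\<tau> (chart_map c p)))
        (frechet_derivative \<tau> (at (chart_map c p)) w)"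
      using True unfolding veq chart_vec_def frechet_derivative_compose[OF d\<tau> df] by simp
    then show ?thesis
      using linear_0[OF linear_frechet_derivative[OF df]] by (simp add: w0)
  \<comment> \<open>On functions not smooth near \<open>p\<close> a tangent vector is 0 by
    convention.\<close>
  qed (simp add: veq chart_vec_def)
qed

lemma coord_field_in_tangent_space:
  "x \<in> A \<Longrightarrow> p \<in> chart_dom x \<Longrightarrow> coord_field M A x i p \<in> tangent_space M A p"
  unfolding coord_field_def tangent_space_def by blast

text \<open>Smoothness of the derivative of \<open>f\<close> along the field must be checked in
  every chart \<open>c\<close>. There it is the partial derivative \<open>D\<close>, computed in the
  chart \<open>x\<close>, composed with the transition map from \<open>c\<close> to
  \<open>x\<close>.\<close>

lemma vector_field_on_coord_field:
  fixes A :: "('a, 'n::finite) chart set" and x :: "('a, 'n) chart"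
  assumes M: "smooth_manifold M A" and x: "x \<in> A"
  shows "vector_field_on M A (chart_dom x) (coord_field M A x i)"
  unfolding vector_field_on_def
proof (intro conjI ballI allI impI)
  note chx = smooth_manifold_chart[OF M x]
  show "openin M (chart_dom x)" by (rule chart_dom_openin[OF chx])
  show "coord_field M A x i p \<in> tangent_space M A p" if "p \<in> chart_dom x" for p
    using x that by (rule coord_field_in_tangent_space)
  fix V f assume "openin M V \<and> V \<subseteq> chart_dom x \<and> smooth_fun A V f"
  then have V: "openin M V" "V \<subseteq> chart_dom x" and f: "smooth_fun A V f" by auto
  define D where "D = (\<lambda>y. frechet_derivative (f \<circ> chart_inv x) (at y) (axis i 1))"
  \<comment> \<open>Order \<open>Suc k\<close> of \<open>f\<close> in the chart \<open>x\<close>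
    yields order \<open>k\<close> of \<open>D\<close>; smoothness supplies every order.\<close>
  have Dk: "Ck_on k (chart_map x ` (chart_dom x \<inter> V)) D" for k
    using f x unfolding smooth_fun_def smooth_on_def D_def by (metis Ck_on.simps(2))
  have Deq: "coord_field M A x i p f = D (chart_map x p)" if "p \<in> V" for p
  proof -
    have "smooth_at M A p f"
      using that V f by (auto simp: smooth_at_def)
    then show ?thesis by (simp add: coord_field_def chart_vec_def D_def)
  qed
  have "smooth_fun A V (\<lambda>p. D (chart_map x p))"
    unfolding smooth_fun_def smooth_on_def
  proof (intro ballI allI)
    fix c k assume c: "c \<in> A"
    note chc = smooth_manifold_chart[OF M c]
    have "Ck_on k (chart_map c ` (chart_dom c \<inter> V)) (D \<circ> (chart_map x \<circ> chart_inv c))"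
    proof (rule Ck_on_compose[OF is_chart_open_image[OF chc V(1)] _ Dk])
      show "(chart_map x \<circ> chart_inv c) ` chart_map c ` (chart_dom c \<inter> V)
          \<subseteq> chart_map x ` (chart_dom x \<inter> V)"
        using V by (auto simp: chart_inv_map[OF chc])
      show "Ck_on k (chart_map c ` (chart_dom c \<inter> V)) (chart_map x \<circ> chart_inv c)"
        using smooth_on_transition[OF M c x] V unfolding smooth_on_def
        by (blast intro: Ck_on_subset)
    qed
    then show "Ck_on k (chart_map c ` (chart_dom c \<inter> V)) ((\<lambda>p. D (chart_map x p)) \<circ> chart_inv c)"
      by (simp add: comp_def)
  qed
  then show "smooth_fun A V (\<lambda>p. coord_field M A x i p f)"
    using smooth_fun_cong[OF M V(1), of "\<lambda>p. D (chart_map x p)"] Deq by simp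
qed


section \<open>Affine coordinates\<close>

lemma affine_chart_parallel:
  assumes M: "smooth_manifold M A" and conn: "affine_connection M A nabla"
    and x: "affine_chart M A nabla x" and p: "p \<in> chart_dom x"
  shows "nabla (coord_field M A x i) (coord_field M A x j) p = (\<lambda>f. 0)"
proof -
  let ?X = "coord_field M A x i" and ?Y = "coord_field M A x j"
  have xA: "x \<in> A" using x by (simp add: affine_chart_def)
  note vf = vector_field_on_coord_field[OF M xA]
  show ?thesis
  proof (rule tangent_vector_eq_0[OF M xA p])
    have "vector_field_on M A (chart_dom x) (nabla ?X ?Y)"
      using conn vf[of i] vf[of j] unfolding affine_connection_def by blast
    then show "nabla ?X ?Y p \<in> tangent_space M A p"
      using p by (simp add: vector_field_on_def)
    fix k
    have "cov_deriv_form nabla (differential (\<lambda>q. chart_map x q $ k)) ?X ?Y p = 0"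
      using x p vf[of i] vf[of j] unfolding affine_chart_def by blast
    \<comment> \<open>The inner function is dx^k applied to the field \<open>?Y\<close>. It is
      constant on the chart domain, so in the formula for the covariant derivative of dx^k only the
      term containing \<open>nabla ?X ?Y p\<close> survives.\<close>
    moreover have "?X p (\<lambda>q. ?Y q (\<lambda>q. chart_map x q $ k)) = 0"
      unfolding coord_field_def[of M A x i]
      by (rule chart_vec_const[OF M xA p chart_dom_openin[OF smooth_manifold_chart[OF M xA]] p])
        (rule coord_field_coord[OF M xA])
    ultimately show "nabla ?X ?Y p (\<lambda>q. chart_map x q $ k) = 0"
      by (simp add: cov_deriv_form_def differential_def)
  qed
qed

text \<open>This disposes of the two connection terms in the covariant derivative of the metric once
  the coordinate fields are parallel. The first slot follows from linearity with both coefficients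
  0, the second from symmetry.\<close>

lemma riemannian_metric_zero:
  assumes g: "riemannian_metric M A g" and p: "p \<in> topspace M" and v: "v \<in> tangent_space M A p"
  shows "g p (\<lambda>f. 0) v = 0" "g p v (\<lambda>f. 0) = 0"
proof -
  have lin: "g p (\<lambda>f. r * v f + s * v f) v = r * g p v v + s * g p v v" for r s
    using g p v unfolding riemannian_metric_def by blast
  from lin[of 0 0] show "g p (\<lambda>f. 0) v = 0" by simp
  \<comment> \<open>Symmetry is available for tangent vectors only, so the zero functional has to be
    exhibited as one: it is the direction 0 in any chart around \<open>p\<close>.\<close>
  have "chart_vec M A c 0 p f = 0" if "c \<in> A" "p \<in> chart_dom c" for c f
    using linear_0[OF linear_frechet_derivative[OF smooth_at_imp_differentiable[OF _ that]]]
    by (simp add: chart_vec_def)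
  then have "(\<lambda>f. 0) \<in> tangent_space M A p"
    using v unfolding tangent_space_def by force
  then have "g p v (\<lambda>f. 0) = g p (\<lambda>f. 0) v"
    using g p v unfolding riemannian_metric_def by blast
  then show "g p v (\<lambda>f. 0) = 0" using \<open>g p (\<lambda>f. 0) v = 0\<close> by simp
qed

lemma nabla_metric_comp_eq_pd3:
  assumes hess: "hessian_manifold M A g nabla" and x: "affine_chart M A nabla x"
    and pot: "potential_on M A g x W \<Phi>" and p: "p \<in> W"
  shows "nabla_metric_comp M A g nabla x f i j p = pd3 M A x \<Phi> f i j p"
proof -
  have M: "smooth_manifold M A" and g: "riemannian_metric M A g"
    and conn: "affine_connection M A nabla"
    using hess by (auto simp: hessian_manifold_def)
  have xA: "x \<in> A" using x by (simp add: affine_chart_def)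
  have W: "openin M W" and px: "p \<in> chart_dom x"
    using pot p by (auto simp: potential_on_def)
  have pM: "p \<in> topspace M" using W p openin_subset by blast
  have "g q (coord_field M A x i q) (coord_field M A x j q) = pd2 M A x \<Phi> i j q" if "q \<in> W" for q
    using pot that by (simp add: potential_on_def metric_matrix_def)
  then have "coord_field M A x f p (\<lambda>q. g q (coord_field M A x i q) (coord_field M A x j q)) =
      pd3 M A x \<Phi> f i j p"
    \<comment> \<open>The metric components equal the second derivatives of \<open>\<Phi>\<close> on
      \<open>W\<close>. Since \<open>W\<close> is open and tangent vectors act locally, their
      derivatives at \<open>p\<close> agree.\<close>
    unfolding pd3_def coord_field_def[of M A x f]
    by (rule chart_vec_cong[OF M xA px W p])
  then show ?thesis
    using riemannian_metric_zero[OF g pM coord_field_in_tangent_space[OF xA px]]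
    by (simp add: nabla_metric_comp_def cov_deriv_metric_def affine_chart_parallel[OF M conn x px])
qed

text \<open>Interchanging the two sums produces the index order of the Associativity Equation. With
  \<open>h\<close> arbitrary, the same rewriting serves both sides of the theorem.\<close>

lemma sum_pd3_up:
  "(\<Sum>f\<in>UNIV. pd3_up M A g x \<Phi> f i j p * h f) =
    (\<Sum>e\<in>UNIV. \<Sum>f\<in>UNIV. pd3 M A x \<Phi> i j e p * inv_metric M A g x e f p * h f)"
  unfolding pd3_up_def sum_distrib_right by (rule sum.swap)

theorem proposition2p5p1:
  fixes M :: "'a topology" and A :: "('a, 'n::finite) chart set"
    and g :: "'a metric2" and nabla :: "'a conn"
    and x :: "('a, 'n) chart" and W :: "'a set" and \<Phi> :: "'a \<Rightarrow> real"
    and p :: 'a and a b c d :: 'n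
  assumes "hessian_manifold M A g nabla"
    and "associativity_equation M A g nabla"
    and "affine_chart M A nabla x"
    and "potential_on M A g x W \<Phi>"
    and "p \<in> W"
  shows "(\<Sum>f\<in>UNIV. pd3_up M A g x \<Phi> f a b p * nabla_metric_comp M A g nabla x f c d p) =
         (\<Sum>f\<in>UNIV. pd3_up M A g x \<Phi> f b c p * nabla_metric_comp M A g nabla x f a d p)"
  \<comment> \<open>After rewriting, the goal is the Associativity Equation for
    \<open>\<Phi>\<close> at \<open>p\<close> with \<open>i\<close>, \<open>j\<close>,
    \<open>k\<close>, \<open>l\<close> taken as \<open>a\<close>, \<open>b\<close>,
    \<open>c\<close>, \<open>d\<close>.\<close>
  using assms(2-5) unfolding sum_pd3_up nabla_metric_comp_eq_pd3[OF assms(1,3,4,5)]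
    associativity_equation_def by blast

end
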